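(* The cover graph of every finite upper locally distributive lattice admits a U-coloring.
   Context: The cover graph of a poset has an arc $(x,y)$ whenever $y$ covers $x$. For a digraph $D=(V,A)$, an arc coloring $c$ is a U-coloring if for all $u,v,w\in V$ with $u\neq w$ and $(v,u),(v,w)\in A$: (U$_1$) $c(v,u)\neq c(v,w)$; (U$_2$) there is $z\in V$ with arcs $(u,z),(w,z)\in A$ such that $c(v,u)=c(w,z)$ and $c(v,w)=c(u,z)$. A poset $P$ is an upper locally distributive lattice if $P$ is a lattice and there is a map $x\mapsto M_x$ assigning to each $x\in P$ a set $M_x$ of meet-irreducible elements with $x=\bigwedge M_x$ and such that whenever $x=\bigwedge B$ for a set $B$ of meet-irreducibles then $M_x\subseteq B$. *)

theory Defs
  imports "HOL-Algebra.Lattice" "Graph_Theory.Pair_Digraph"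
begin

definition covers :: "('a, 'b) gorder_scheme \<Rightarrow> 'a \<Rightarrow> 'a \<Rightarrow> bool" where
  "covers L y x \<longleftrightarrow> x \<in> carrier L \<and> y \<in> carrier L \<and> x \<sqsubset>\<^bsub>L\<^esub> y \<and>
     \<not> (\<exists>z \<in> carrier L. x \<sqsubset>\<^bsub>L\<^esub> z \<and> z \<sqsubset>\<^bsub>L\<^esub> y)"

definition cover_graph :: "('a, 'b) gorder_scheme \<Rightarrow> 'a pair_pre_digraph" where
  "cover_graph L = \<lparr> pverts = carrier L, parcs = {(x, y). covers L y x} \<rparr>"

text \<open>The value of \<open>c\<close> on pairs that are not arcs is irrelevant.\<close>

definition U_coloring :: "'a pair_pre_digraph \<Rightarrow> ('a \<times> 'a \<Rightarrow> 'c) \<Rightarrow> bool" where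
  "U_coloring D c \<longleftrightarrow>
     (\<forall>u \<in> pverts D. \<forall>v \<in> pverts D. \<forall>w \<in> pverts D.
        u \<noteq> w \<longrightarrow> (v, u) \<in> parcs D \<longrightarrow> (v, w) \<in> parcs D \<longrightarrow>
          c (v, u) \<noteq> c (v, w) \<and>
          (\<exists>z \<in> pverts D. (u, z) \<in> parcs D \<and> (w, z) \<in> parcs D \<and>
             c (v, u) = c (w, z) \<and> c (v, w) = c (u, z)))"

text \<open>Stated with the greatest-lower-bound relation instead of the choice-based operator
  \<open>inf L\<close>, so that \<open>B\<close> is required to have an infimum. The empty
  meet is the greatest element.\<close>

definition is_meet :: "('a, 'b) gorder_scheme \<Rightarrow> 'a \<Rightarrow> 'a set \<Rightarrow> bool" where
  "is_meet L x B \<longleftrightarrow> greatest L x (Lower L B)"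

text \<open>The greatest element, being the empty meet, is not meet-irreducible.\<close>

definition meet_irreducible :: "('a, 'b) gorder_scheme \<Rightarrow> 'a \<Rightarrow> bool" where
  "meet_irreducible L m \<longleftrightarrow> m \<in> carrier L \<and> \<not> greatest L m (carrier L) \<and>
     (\<forall>a \<in> carrier L. \<forall>b \<in> carrier L. is_meet L m {a, b} \<longrightarrow> m = a \<or> m = b)"

definition upper_locally_distributive_lattice :: "('a, 'b) gorder_scheme \<Rightarrow> bool" where
  "upper_locally_distributive_lattice L \<longleftrightarrow> lattice L \<and>
     (\<exists>M. \<forall>x \<in> carrier L.
        M x \<subseteq> {m. meet_irreducible L m} \<and> is_meet L x (M x) \<and>
        (\<forall>B. B \<subseteq> {m. meet_irreducible L m} \<longrightarrow> is_meet L x B \<longrightarrow> M x \<subseteq> B))"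

end

theory Submission
  imports Defs
begin

text \<open>
  Represent each element \<open>x\<close> by the set \<open>U x\<close> of meet-irreducibles above it; this is an order
  embedding for reverse inclusion and turns joins into intersections. If \<open>y\<close> covers \<open>x\<close> and
  \<open>m \<in> U x - U y\<close>, then \<open>x = y \<sqinter> m\<close> is the meet of \<open>insert m (U y)\<close>, so minimality of \<open>M x\<close> forces
  \<open>M x - U y \<subseteq> {m}\<close>. As \<open>M x - U y\<close> is nonempty, \<open>U x - U y\<close> is a singleton, and its element is the
  color of the cover \<open>(x, y)\<close>. Two covers \<open>u \<noteq> w\<close> of \<open>v\<close> then delete distinct elements of \<open>U v\<close>,
  and \<open>u \<squnion> w\<close> is obtained by deleting both.
\<close>

definition meet_irreducibles_above :: "('a, 'b) gorder_scheme \<Rightarrow> 'a \<Rightarrow> 'a set" where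
  "meet_irreducibles_above L x = {m. meet_irreducible L m \<and> x \<sqsubseteq>\<^bsub>L\<^esub> m}"

definition cover_color :: "('a, 'b) gorder_scheme \<Rightarrow> 'a \<times> 'a \<Rightarrow> 'a" where
  "cover_color L = (\<lambda>(x, y). the_elem (meet_irreducibles_above L x - meet_irreducibles_above L y))"

lemma meet_irreducible_closed: "meet_irreducible L m \<Longrightarrow> m \<in> carrier L"
  by (simp add: meet_irreducible_def)

text \<open>Fixing one witness \<open>M\<close> of the existential in the definition of upper local
  distributivity makes \<open>M x\<close> available as a canonical minimal representation of
  \<open>x\<close>.\<close>

locale uld_lattice = lattice L for L :: "('a, 'b) gorder_scheme" (structure) +
  fixes M :: "'a \<Rightarrow> 'a set"
  assumes M_irreducible: "\<And>x m. x \<in> carrier L \<Longrightarrow> m \<in> M x \<Longrightarrow> meet_irreducible L m"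
    and M_meet: "\<And>x. x \<in> carrier L \<Longrightarrow> is_meet L x (M x)"
    and M_least: "\<And>x B. \<lbrakk>x \<in> carrier L; \<And>m. m \<in> B \<Longrightarrow> meet_irreducible L m; is_meet L x B\<rbrakk>
      \<Longrightarrow> M x \<subseteq> B"
begin

abbreviation U :: "'a \<Rightarrow> 'a set" where
  "U \<equiv> meet_irreducibles_above L"

lemma less_iff: "x \<sqsubset> y \<longleftrightarrow> x \<sqsubseteq> y \<and> x \<noteq> y"
  by (simp add: lless_eq)

lemma M_lower: "x \<in> carrier L \<Longrightarrow> m \<in> M x \<Longrightarrow> x \<sqsubseteq> m"
  using M_meet[of x] M_irreducible[of x m]
  by (auto simp: is_meet_def greatest_def Lower_def meet_irreducible_closed)

lemma M_greatest:
  assumes "x \<in> carrier L" "y \<in> carrier L" "\<And>m. m \<in> M x \<Longrightarrow> y \<sqsubseteq> m"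
  shows "y \<sqsubseteq> x"
  using M_meet[of x] assms by (auto simp: is_meet_def greatest_def Lower_def)

lemma M_subset_U: "x \<in> carrier L \<Longrightarrow> M x \<subseteq> U x"
  by (simp add: M_irreducible M_lower meet_irreducibles_above_def subset_iff)

text \<open>Since \<open>M y\<close> is contained in \<open>U y\<close> and has meet
  \<open>y\<close>, an element below all of \<open>U y\<close> is already below \<open>y\<close>.
  The other direction is transitivity.\<close>

lemma U_subset_iff:
  assumes "x \<in> carrier L" "y \<in> carrier L"
  shows "U y \<subseteq> U x \<longleftrightarrow> x \<sqsubseteq> y"
proof
  assume "U y \<subseteq> U x"
  then have "\<And>m. m \<in> M y \<Longrightarrow> x \<sqsubseteq> m"
    using M_subset_U[OF assms(2)] by (auto simp: meet_irreducibles_above_def)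
  then show "x \<sqsubseteq> y"
    using M_greatest assms by blast
next
  assume "x \<sqsubseteq> y"
  then show "U y \<subseteq> U x"
    using assms by (auto simp: meet_irreducibles_above_def meet_irreducible_closed intro: le_trans)
qed

lemma U_inject: "x \<in> carrier L \<Longrightarrow> y \<in> carrier L \<Longrightarrow> U x = U y \<Longrightarrow> x = y"
  using U_subset_iff[of x y] U_subset_iff[of y x] le_antisym[of x y] by simp

lemma U_join:
  assumes "x \<in> carrier L" "y \<in> carrier L"
  shows "U (x \<squnion> y) = U x \<inter> U y"
proof -
  have "x \<squnion> y \<sqsubseteq> m \<longleftrightarrow> x \<sqsubseteq> m \<and> y \<sqsubseteq> m" if "m \<in> carrier L" for m
    using assms that join_le[of x m y] join_left[of x y] join_right[of x y]
      le_trans[of x "x \<squnion> y" m] le_trans[of y "x \<squnion> y" m]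
    by auto
  then show ?thesis
    by (auto simp: meet_irreducibles_above_def meet_irreducible_closed)
qed

lemma covers_D:
  assumes "covers L y x"
  shows "x \<in> carrier L" "y \<in> carrier L" "x \<sqsubseteq> y" "x \<noteq> y"
  using assms by (auto simp: covers_def less_iff)

lemma covers_between:
  assumes "covers L y x" "z \<in> carrier L" "x \<sqsubseteq> z" "z \<sqsubseteq> y"
  shows "z = x \<or> z = y"
  using assms by (auto simp: covers_def less_iff)

lemma is_meet_insert_cover:
  assumes xy: "covers L y x" and m: "m \<in> U x - U y"
  shows "is_meet L x (insert m (U y))"
proof -
  note c = covers_D[OF xy]
  have mc: "m \<in> carrier L" "x \<sqsubseteq> m" "\<not> y \<sqsubseteq> m"
    using m by (auto simp: meet_irreducibles_above_def meet_irreducible_closed)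
  \<comment> \<open>Equality would put \<open>y\<close> below \<open>m\<close>, against
    \<open>m \<notin> U y\<close>. So \<open>y \<sqinter> m\<close> lies in the interval from
    \<open>x\<close> to \<open>y\<close> and differs from \<open>y\<close>, which leaves only
    \<open>x\<close>.\<close>
  have "y \<sqinter> m \<noteq> y"
    using c mc meet_right[of y m] by auto
  then have meet: "y \<sqinter> m = x"
    using covers_between[OF xy, of "y \<sqinter> m"] c mc meet_le[of x y m] meet_left[of y m] by auto
  have "x \<sqsubseteq> b" if "b \<in> insert m (U y)" for b
    using that mc U_subset_iff[OF c(1,2)] c(3) by (auto simp: meet_irreducibles_above_def)
  moreover have "z \<sqsubseteq> x" if "z \<in> Lower L (insert m (U y))" for z
  proof -
    have z: "z \<in> carrier L" "\<And>b. b \<in> insert m (U y) \<Longrightarrow> b \<in> carrier L \<Longrightarrow> z \<sqsubseteq> b"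
      using that by (auto simp: Lower_def)
    have "z \<sqsubseteq> y"
    \<comment> \<open>A lower bound of \<open>U y\<close> is one of its subset \<open>M y\<close>,
      whose meet is \<open>y\<close>.\<close>
    proof (rule M_greatest[OF c(2) z(1)])
      fix b assume b: "b \<in> M y"
      then have "b \<in> insert m (U y)"
        using M_subset_U[OF c(2)] by blast
      then show "z \<sqsubseteq> b"
        by (rule z(2)) (rule meet_irreducible_closed[OF M_irreducible[OF c(2) b]])
    qed
    moreover have "z \<sqsubseteq> m"
      using z(2)[of m] mc(1) by simp
    ultimately show ?thesis
      using meet meet_le[of z y m] z(1) c(2) mc(1) by auto
  qed
  ultimately show ?thesis
    using c by (auto simp: is_meet_def greatest_def Lower_def)
qed

lemma U_cover:
  assumes "covers L y x"
  obtains m where "meet_irreducible L m" "U x = insert m (U y)" "m \<notin> U y"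
proof -
  note c = covers_D[OF assms]
  have "\<not> y \<sqsubseteq> x"
    using c le_antisym by blast
  \<comment> \<open>Otherwise \<open>y\<close> would be a lower bound of \<open>M x\<close> and
    hence lie below \<open>x\<close>.\<close>
  then have "\<not> M x \<subseteq> U y"
    using M_greatest[OF c(1,2)] unfolding meet_irreducibles_above_def by blast
  then obtain a where a: "a \<in> M x" "a \<notin> U y" by blast
  \<comment> \<open>Minimality gives \<open>M x \<subseteq> insert m (U y)\<close>, and
    \<open>a\<close> lies in \<open>M x\<close> but outside \<open>U y\<close>.\<close>
  have "a = m" if "m \<in> U x - U y" for m
    using M_least[OF c(1) _ is_meet_insert_cover[OF assms that]] a that
    by (auto simp: meet_irreducibles_above_def)
  moreover have "U y \<subseteq> U x"
    using U_subset_iff c by blast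
  ultimately have "U x = insert a (U y)"
    using a M_subset_U[OF c(1)] by blast
  with that M_irreducible[OF c(1) a(1)] a(2) show thesis by blast
qed

text \<open>Converse of \<open>U_cover\<close>: no set lies strictly between \<open>U y\<close> and
  \<open>insert m (U y)\<close>, and \<open>U\<close> is injective and reverses the order.\<close>

lemma covers_if_U_eq_insert:
  assumes x: "x \<in> carrier L" and y: "y \<in> carrier L"
    and U: "U x = insert m (U y)" "m \<notin> U y"
  shows "covers L y x"
proof -
  have "x \<sqsubseteq> y" "x \<noteq> y"
    using U U_subset_iff[OF x y] by auto
  moreover have "z = x \<or> z = y" if z: "z \<in> carrier L" "x \<sqsubseteq> z" "z \<sqsubseteq> y" for z
  proof -
    have "U y \<subseteq> U z" "U z \<subseteq> insert m (U y)"
      using z U_subset_iff x y U(1) by blast+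
    then have "U z = U y \<or> U z = U x"
      unfolding U(1) by blast
    then show ?thesis
      using U_inject[OF z(1) x] U_inject[OF z(1) y] by blast
  qed
  ultimately show ?thesis
    using x y by (auto simp: covers_def less_iff)
qed

lemma cover_color_eq: "U x = insert m (U y) \<Longrightarrow> m \<notin> U y \<Longrightarrow> cover_color L (x, y) = m"
  by (simp add: cover_color_def insert_Diff_if)

text \<open>Confines the colors to the finite carrier, so that they can be numbered.\<close>

lemma cover_color_closed:
  assumes "covers L y x"
  shows "cover_color L (x, y) \<in> carrier L"
proof -
  obtain m where "meet_irreducible L m" "U x = insert m (U y)" "m \<notin> U y"
    using U_cover[OF assms] .
  then show ?thesis
    by (simp add: cover_color_eq meet_irreducible_closed)
qed

lemma U_coloring_cover_color: "U_coloring (cover_graph L) (cover_color L)"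
proof -
  have "cover_color L (v, u) \<noteq> cover_color L (v, w) \<and>
     (\<exists>z \<in> carrier L. covers L z u \<and> covers L z w \<and>
        cover_color L (v, u) = cover_color L (w, z) \<and> cover_color L (v, w) = cover_color L (u, z))"
    if ne: "u \<noteq> w" and vu: "covers L u v" and vw: "covers L w v" for u v w
  proof -
    note c = covers_D[OF vu] covers_D[OF vw]
    obtain a where a: "U v = insert a (U u)" "a \<notin> U u"
      using U_cover[OF vu] .
    obtain b where b: "U v = insert b (U w)" "b \<notin> U w"
      using U_cover[OF vw] .
    \<comment> \<open>Cancelling a common inserted element would give \<open>U u = U w\<close>,
      hence \<open>u = w\<close>.\<close>
    have ab: "a \<noteq> b"
      using a b ne U_inject[OF c(2) c(6)] insert_ident by metis
    define z where "z = u \<squnion> w"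
    have z: "z \<in> carrier L" "U z = U u \<inter> U w"
      using c U_join by (auto simp: z_def)
    \<comment> \<open>\<open>U z\<close> is \<open>U v\<close> without \<open>a\<close> and
      \<open>b\<close>; as \<open>a\<close> is already gone at \<open>u\<close>, only
      \<open>b\<close> remains to be deleted, and symmetrically at \<open>w\<close>.\<close>
    have uz: "U u = insert b (U z)" "b \<notin> U z"
      using a b z(2) ab by auto
    have wz: "U w = insert a (U z)" "a \<notin> U z"
      using a b z(2) ab by auto
    have "covers L z u" "covers L z w"
      using covers_if_U_eq_insert[OF _ z(1)] uz wz c by simp_all
    then show ?thesis
      using z(1) ab cover_color_eq[OF a] cover_color_eq[OF b] cover_color_eq[OF uz]
        cover_color_eq[OF wz] by auto
  qed
  then show ?thesis
    by (simp add: U_coloring_def cover_graph_def)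
qed

end

text \<open>Both conditions on a U-coloring only compare colors of arcs for equality, so injectivity
  on the colors in use suffices.\<close>

lemma U_coloring_inj_comp:
  assumes "U_coloring D c" "inj_on f (c ` parcs D)"
  shows "U_coloring D (f \<circ> c)"
proof -
  have "f (c e) = f (c e') \<longleftrightarrow> c e = c e'" if "e \<in> parcs D" "e' \<in> parcs D" for e e'
    using that assms(2) by (simp add: inj_on_eq_iff)
  with assms(1) show ?thesis
    unfolding U_coloring_def o_apply by simp metis
qed

theorem theorem4:
  fixes L :: "('a, 'b) gorder_scheme"
  assumes "upper_locally_distributive_lattice L"
    and "finite (carrier L)"
  shows "\<exists>c :: 'a \<times> 'a \<Rightarrow> nat. U_coloring (cover_graph L) c"
proof -
  interpret lattice L
    using assms(1) by (simp add: upper_locally_distributive_lattice_def)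
  obtain M where M: "\<forall>x \<in> carrier L.
        M x \<subseteq> {m. meet_irreducible L m} \<and> is_meet L x (M x) \<and>
        (\<forall>B. B \<subseteq> {m. meet_irreducible L m} \<longrightarrow> is_meet L x B \<longrightarrow> M x \<subseteq> B)"
    using assms(1) unfolding upper_locally_distributive_lattice_def by blast
  interpret uld_lattice L M
  proof unfold_locales
    show "meet_irreducible L m" if "x \<in> carrier L" "m \<in> M x" for x m
      using M that by blast
    show "is_meet L x (M x)" if "x \<in> carrier L" for x
      using M that by blast
    show "M x \<subseteq> B" if "x \<in> carrier L" "\<And>m. m \<in> B \<Longrightarrow> meet_irreducible L m" "is_meet L x B" for x B
    proof -
      have "B \<subseteq> {m. meet_irreducible L m}"
        using that(2) by blast
      with M that(1,3) show ?thesis by simp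
    qed
  qed
  \<comment> \<open>Finiteness enters here: numbering the carrier turns the lattice elements used as
    colors into natural numbers.\<close>
  obtain f :: "'a \<Rightarrow> nat" where f: "inj_on f (carrier L)"
    using finite_imp_inj_to_nat_seg[OF assms(2)] by blast
  have "cover_color L ` parcs (cover_graph L) \<subseteq> carrier L"
    using cover_color_closed by (auto simp: cover_graph_def)
  with f have "inj_on f (cover_color L ` parcs (cover_graph L))"
    by (rule inj_on_subset)
  with U_coloring_cover_color show ?thesis
    by (intro exI) (rule U_coloring_inj_comp)
qed

end
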